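(* Given a set $P=\{\tau_0,\dots,\tau_{k-1}\}$ of $k$ positive reals, one can compute, in time $O(k^2)$, a 4-robust schedule $X$ whose consistency $c(X,P)$ is minimum among all 4-robust schedules.
   Context: A (contract) schedule is an increasing bi-infinite sequence $X=(x_i)_{i\in\mathbb{Z}}$ of positive reals with $\sum_{j\le i}x_j<\infty$; contracts are executed consecutively and contract $i$ completes at time $\sum_{j\le i}x_j$. For $T>0$, $\ell(X,T)$ is the largest length $x_i$ of a contract completed by time $T$. The robustness of $X$ is $\sup_{T>0}T/\ell(X,T)$; $X$ is $r$-robust if this is at most $r$. Given a prediction set $P$ of possible interruption times, the consistency of $X$ is $c(X,P)=\sup_{\tau\in P}\tau/\ell(X,\tau)$. Every 4-robust schedule has the form $(2^{i+\delta})_{i\in\mathbb{Z}}$ for some $\delta\in[0,1)$ (up to index shift), so a schedule is output by giving $\delta$. *)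

theory Defs
  imports "HOL-Analysis.Infinite_Sum" "HOL-Library.Landau_Symbols" "HOL-Library.Extended_Real"
begin

section \<open>Contract schedules\<close>

definition contract_schedule :: "(int \<Rightarrow> real) \<Rightarrow> bool" where
  "contract_schedule X \<longleftrightarrow>
     strict_mono X \<and> (\<forall>i. 0 < X i) \<and> (\<forall>i. X summable_on {..i})"

definition completion_time :: "(int \<Rightarrow> real) \<Rightarrow> int \<Rightarrow> real" where
  "completion_time X i = (\<Sum>\<^sub>\<infinity>j\<in>{..i}. X j)"

text \<open>For every schedule and every \<open>T > 0\<close> infinitely many contracts are completed by time \<open>T\<close>,
  so \<^const>\<open>Max\<close> is not applicable; the greatest length nevertheless exists.\<close>

definition longest_completed :: "(int \<Rightarrow> real) \<Rightarrow> real \<Rightarrow> real" where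
  "longest_completed X T = (GREATEST l. \<exists>i. l = X i \<and> completion_time X i \<le> T)"

definition robustness :: "(int \<Rightarrow> real) \<Rightarrow> ereal" where
  "robustness X = (SUP T\<in>{0<..}. ereal (T / longest_completed X T))"

definition robust_schedule :: "real \<Rightarrow> (int \<Rightarrow> real) \<Rightarrow> bool" where
  "robust_schedule r X \<longleftrightarrow> contract_schedule X \<and> robustness X \<le> ereal r"

definition consistency :: "(int \<Rightarrow> real) \<Rightarrow> real set \<Rightarrow> ereal" where
  "consistency X P = (SUP \<tau>\<in>P. ereal (\<tau> / longest_completed X \<tau>))"

definition doubling_schedule :: "real \<Rightarrow> int \<Rightarrow> real" where
  "doubling_schedule \<delta> i = 2 powr (of_int i + \<delta>)"


section \<open>A real RAM with unit costs\<close>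

text \<open>A program works on finitely many index registers holding natural numbers and on an unbounded
  array of real cells. Real cells are only addressed through index registers: an operand \<open>a\<close> of an
  operation on reals denotes the cell whose address is stored in index register \<open>a\<close>.
  Besides the field operations and comparisons the machine offers the base-2 logarithm and the
  floor function, which are needed to pass from a time \<open>2 powr (i + \<delta>)\<close> to \<open>\<delta>\<close>. The floor is again
  a real and cannot be used as an address. The only constants are integers.\<close>

datatype binop = Add | Sub | Mul | Div

datatype unop = Copy | Floor | Log2

datatype test = Index_Less nat nat | Real_Less nat nat

datatype com =
    Skip
  | Index_Const nat nat
  | Index_Add nat nat nat
  | Index_Sub nat nat nat
  | Real_Const nat int
  | Real_Un unop nat nat
  | Real_Bin binop nat nat nat
  | Seq com com
  | If_Then_Else test com com
  | While test com

type_synonym state = "(nat \<Rightarrow> nat) \<times> (nat \<Rightarrow> real)"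

fun binop_defined :: "binop \<Rightarrow> real \<Rightarrow> real \<Rightarrow> bool" where
  "binop_defined Div x y \<longleftrightarrow> y \<noteq> 0"
| "binop_defined _ x y \<longleftrightarrow> True"

fun binop_val :: "binop \<Rightarrow> real \<Rightarrow> real \<Rightarrow> real" where
  "binop_val Add x y = x + y"
| "binop_val Sub x y = x - y"
| "binop_val Mul x y = x * y"
| "binop_val Div x y = x / y"

fun unop_defined :: "unop \<Rightarrow> real \<Rightarrow> bool" where
  "unop_defined Log2 x \<longleftrightarrow> 0 < x"
| "unop_defined _ x \<longleftrightarrow> True"

fun unop_val :: "unop \<Rightarrow> real \<Rightarrow> real" where
  "unop_val Copy x = x"
| "unop_val Floor x = of_int \<lfloor>x\<rfloor>"
| "unop_val Log2 x = log 2 x"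

fun test_val :: "test \<Rightarrow> state \<Rightarrow> bool" where
  "test_val (Index_Less a b) (R, M) \<longleftrightarrow> R a < R b"
| "test_val (Real_Less a b) (R, M) \<longleftrightarrow> M (R a) < M (R b)"

text \<open>\<open>exec c s n s'\<close>: started in \<open>s\<close>, program \<open>c\<close> halts in \<open>s'\<close> after \<open>n\<close> steps, where every
  elementary operation and every evaluation of a test counts as one step. There is no execution
  through an undefined operation.\<close>

inductive exec :: "com \<Rightarrow> state \<Rightarrow> nat \<Rightarrow> state \<Rightarrow> bool" where
  Skip: "exec Skip s 1 s"
| Index_Const: "exec (Index_Const a m) (R, M) 1 (R(a := m), M)"
| Index_Add: "exec (Index_Add a b c) (R, M) 1 (R(a := R b + R c), M)"
| Index_Sub: "exec (Index_Sub a b c) (R, M) 1 (R(a := R b - R c), M)"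
| Real_Const: "exec (Real_Const a z) (R, M) 1 (R, M(R a := of_int z))"
| Real_Un: "unop_defined f (M (R b)) \<Longrightarrow>
    exec (Real_Un f a b) (R, M) 1 (R, M(R a := unop_val f (M (R b))))"
| Real_Bin: "binop_defined f (M (R b)) (M (R c)) \<Longrightarrow>
    exec (Real_Bin f a b c) (R, M) 1 (R, M(R a := binop_val f (M (R b)) (M (R c))))"
| Seq: "exec c1 s m s' \<Longrightarrow> exec c2 s' n s'' \<Longrightarrow> exec (Seq c1 c2) s (m + n) s''"
| If_True: "test_val b s \<Longrightarrow> exec c1 s n s' \<Longrightarrow> exec (If_Then_Else b c1 c2) s (Suc n) s'"
| If_False: "\<not> test_val b s \<Longrightarrow> exec c2 s n s' \<Longrightarrow> exec (If_Then_Else b c1 c2) s (Suc n) s'"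
| While_False: "\<not> test_val b s \<Longrightarrow> exec (While b c) s 1 s"
| While_True: "test_val b s \<Longrightarrow> exec c s m s' \<Longrightarrow> exec (While b c) s' n s'' \<Longrightarrow>
    exec (While b c) s (Suc (m + n)) s''"

lemma exec_deterministic:
  assumes "exec c s n t" "exec c s n' t'"
  shows "n = n' \<and> t = t'"
  using assms
proof (induction arbitrary: n' t' rule: exec.induct)
  case (Seq c1 s m s' c2 n s'')
  from Seq.prems Seq.IH show ?case by (cases rule: exec.cases) blast+
next
  case (If_True b s c1 n s' c2)
  from If_True.prems If_True.IH If_True.hyps show ?case by (cases rule: exec.cases) blast+
next
  case (If_False b s c2 n s' c1)
  from If_False.prems If_False.IH If_False.hyps show ?case by (cases rule: exec.cases) blast+
next
  case (While_True b s c m s' n s'')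
  from While_True.prems While_True.IH While_True.hyps show ?case
    by (cases rule: exec.cases) blast+
qed (erule exec.cases; auto)+

text \<open>The number of inputs is passed in index register 0 and the inputs in the first real cells;
  the result is expected in the first real cell.\<close>

definition input_state :: "real list \<Rightarrow> state" where
  "input_state xs =
     ((\<lambda>_. 0)(0 := length xs), (\<lambda>i. if i < length xs then xs ! i else 0))"

definition result :: "state \<Rightarrow> real" where
  "result s = snd s 0"

end

theory Submission imports Defs begin

text \<open>If \<open>X\<close> is 4-robust, its completion times \<open>S\<close> satisfy
  \<open>S (i + 2) \<le> 4 * (S (i + 1) - S i)\<close>, which forces \<open>S\<close> and hence \<open>X\<close> to be geometric with ratio 2.
  For the schedule with offset \<open>\<delta>\<close>, an interruption at \<open>\<tau>\<close> has ratio
  \<open>2 powr (1 + frac (log 2 \<tau> - \<delta>))\<close>. Rotating \<open>\<delta>\<close> on the circle up to the next \<open>frac (log 2 \<tau>)\<close>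
  decreases all these ratios, so it suffices to compare the \<open>k\<close> offsets \<open>frac (log 2 \<tau>)\<close>, \<open>\<tau> \<in> P\<close>,
  each of which is evaluated in linear time.\<close>

section \<open>Four-robust schedules\<close>

lemma completion_time_step:
  assumes "contract_schedule X"
  shows "completion_time X (i + 1) = completion_time X i + X (i + 1)"
proof -
  have "{..i + 1} = insert (i + 1) {..i}" by auto
  moreover have "X summable_on {..i}" using assms by (simp add: contract_schedule_def)
  ultimately show ?thesis
    unfolding completion_time_def by (simp add: infsum_insert)
qed

lemma completion_time_mono:
  assumes "contract_schedule X" "i \<le> j"
  shows "completion_time X i \<le> completion_time X j"
  using assms(2)
proof (induction rule: int_ge_induct)
  case (step j)
  have "0 < X (j + 1)" using assms(1) by (simp add: contract_schedule_def)
  then show ?case using step completion_time_step[OF assms(1), of j] by linarith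
qed simp

lemma completion_time_pos:
  assumes "contract_schedule X"
  shows "0 < completion_time X i"
proof -
  have "0 \<le> completion_time X (i - 1)"
    unfolding completion_time_def using assms
    by (intro infsum_nonneg) (simp add: contract_schedule_def less_imp_le)
  moreover have "0 < X i" using assms by (simp add: contract_schedule_def)
  ultimately show ?thesis using completion_time_step[OF assms, of "i - 1"] by simp
qed

text \<open>Completion times are monotone, so every contract completed by \<open>T\<close> has index
  at most \<open>i\<close>, and among those \<open>X i\<close> is the longest.\<close>

lemma longest_completed_eq:
  assumes X: "contract_schedule X"
    and T: "completion_time X i \<le> T" "T < completion_time X (i + 1)"
  shows "longest_completed X T = X i"
  unfolding longest_completed_def
proof (rule Greatest_equality)
  show "\<exists>j. X i = X j \<and> completion_time X j \<le> T" using T by blast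
next
  fix l assume "\<exists>j. l = X j \<and> completion_time X j \<le> T"
  then obtain j where j: "l = X j" "completion_time X j \<le> T" by blast
  have "j \<le> i"
    using completion_time_mono[OF X, of "i + 1" j] j(2) T(2) by (cases "j \<le> i") auto
  moreover have "mono X"
    using X by (simp add: contract_schedule_def strict_mono_mono)
  ultimately show "l \<le> X i" using j(1) by (simp add: monoD)
qed

text \<open>Just before contract \<open>i + 1\<close> completes, the longest completed contract is
  still \<open>X i\<close>. So \<open>T \<le> r * X i\<close> for all \<open>T\<close> slightly
  below that completion time, and density passes the bound to the endpoint.\<close>

lemma robust_schedule_completion_time_le:
  assumes "robust_schedule r X"
  shows "completion_time X (i + 1) \<le> r * X i"
proof (rule dense_le_bounded)
  have X: "contract_schedule X" using assms by (simp add: robust_schedule_def)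
  have pos: "0 < X j" for j using X by (simp add: contract_schedule_def)
  show "completion_time X i < completion_time X (i + 1)"
    using completion_time_step[OF X, of i] pos[of "i + 1"] by simp
  fix T assume T: "completion_time X i < T" "T < completion_time X (i + 1)"
  then have "0 < T" using completion_time_pos[OF X, of i] by linarith
  then have "ereal (T / longest_completed X T) \<le> robustness X"
    unfolding robustness_def by (intro SUP_upper) simp
  also have "\<dots> \<le> ereal r" using assms by (simp add: robust_schedule_def)
  finally show "T \<le> r * X i"
    using longest_completed_eq[OF X, of i T] T pos[of i] by (simp add: field_simps)
qed

text \<open>The ratio of consecutive terms is nonincreasing because \<open>4 - 4 / r \<le> r\<close>, and 2 is the only
  possible limit at either end, so it is constant.\<close>

lemma geometric_if_four_bound:
  fixes S :: "int \<Rightarrow> real"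
  assumes pos: "\<And>i. 0 < S i" and mono: "\<And>i. S i \<le> S (i + 1)"
    and bound: "\<And>i. S (i + 2) \<le> 4 * (S (i + 1) - S i)"
  shows "S (i + 1) = 2 * S i"
proof -
  define r where "r i = S (i + 1) / S i" for i
  have r1: "1 \<le> r i" for i using pos[of i] mono[of i] by (simp add: r_def)
  have rr: "r (i + 1) * r i \<le> 4 * r i - 4" for i
  proof -
    have "r (i + 1) * r i = S (i + 2) / S i"
      using pos[of "i + 1"] by (simp add: r_def add.assoc)
    also have "\<dots> \<le> 4 * (S (i + 1) - S i) / S i"
      using bound[of i] pos[of i] by (intro divide_right_mono) auto
    also have "\<dots> = 4 * r i - 4" using pos[of i] by (simp add: r_def field_simps)
    finally show ?thesis .
  qed
  have dec: "r (i + 1) \<le> r i" for i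
  proof -
    have "r (i + 1) * r i \<le> r i * r i"
      using rr[of i] zero_le_power2[of "r i - 2"] by (simp add: power2_eq_square algebra_simps)
    then show ?thesis using r1[of i] by simp
  qed
  \<comment> \<open>This upper bound makes the ratios converge as the index tends to minus
    infinity.\<close>
  have r4: "r i \<le> 4" for i
  proof -
    have "r i * r (i - 1) \<le> 4 * r (i - 1)" using rr[of "i - 1"] by simp
    then show ?thesis using r1[of "i - 1"] by simp
  qed
  have lim2: "L = 2" if "L * L \<le> 4 * L - 4" for L :: real
  proof -
    have "(L - 2)\<^sup>2 \<le> 0" using that by (simp add: power2_eq_square algebra_simps)
    then show ?thesis by simp
  qed
  \<comment> \<open>The limit at plus infinity bounds the nonincreasing ratios from below; the limit
    at minus infinity, taken afterwards, bounds them from above.\<close>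
  have "2 \<le> r i"
  proof -
    define f where "f n = r (i + int n)" for n
    have "decseq f"
    proof (rule decseq_SucI)
      show "f (Suc n) \<le> f n" for n
        using dec[of "i + int n"] by (simp add: f_def add_ac)
    qed
    then obtain L where L: "f \<longlonglongrightarrow> L" "\<And>n. L \<le> f n"
      using decseq_convergent[of f 1] r1 by (metis f_def)
    have "L * L \<le> 4 * L - 4"
    proof (rule LIMSEQ_le)
      show "(\<lambda>n. f (Suc n) * f n) \<longlonglongrightarrow> L * L"
        using L(1) by (intro tendsto_mult LIMSEQ_Suc)
      show "(\<lambda>n. 4 * f n - 4) \<longlonglongrightarrow> 4 * L - 4"
        using L(1) by (intro tendsto_intros)
      have "f (Suc n) * f n \<le> 4 * f n - 4" for n
        using rr[of "i + int n"] by (simp add: f_def add_ac)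
      then show "\<exists>N. \<forall>n\<ge>N. f (Suc n) * f n \<le> 4 * f n - 4" by blast
    qed
    then show ?thesis using lim2[of L] L(2)[of 0] by (simp add: f_def)
  qed
  moreover have "r i \<le> 2"
  proof -
    define f where "f n = r (i - int n)" for n
    have "incseq f"
    proof (rule incseq_SucI)
      show "f n \<le> f (Suc n)" for n
        using dec[of "i - int (Suc n)"] by (simp add: f_def)
    qed
    then obtain L where L: "f \<longlonglongrightarrow> L" "\<And>n. f n \<le> L"
      using incseq_convergent[of f 4] r4 by (metis f_def)
    have "L * L \<le> 4 * L - 4"
    proof (rule LIMSEQ_le)
      show "(\<lambda>n. f n * f (Suc n)) \<longlonglongrightarrow> L * L"
        using L(1) by (intro tendsto_mult LIMSEQ_Suc)
      show "(\<lambda>n. 4 * f (Suc n) - 4) \<longlonglongrightarrow> 4 * L - 4"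
        using L(1) by (intro tendsto_intros LIMSEQ_Suc)
      have "f n * f (Suc n) \<le> 4 * f (Suc n) - 4" for n
        using rr[of "i - int (Suc n)"] by (simp add: f_def)
      then show "\<exists>N. \<forall>n\<ge>N. f n * f (Suc n) \<le> 4 * f (Suc n) - 4" by blast
    qed
    then show ?thesis using lim2[of L] L(2)[of 0] by (simp add: f_def)
  qed
  ultimately show ?thesis using pos[of i] by (simp add: r_def field_simps)
qed

lemma robust_schedule_4_imp_doubling:
  assumes "robust_schedule 4 X"
  obtains \<delta> where "X = doubling_schedule \<delta>"
proof -
  have X: "contract_schedule X" using assms by (simp add: robust_schedule_def)
  have pos: "0 < X i" for i using X by (simp add: contract_schedule_def)
  let ?S = "completion_time X"
  have S2: "?S (i + 1) = 2 * ?S i" for i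
  proof (rule geometric_if_four_bound)
    show "0 < ?S i" for i by (rule completion_time_pos[OF X])
    show "?S i \<le> ?S (i + 1)" for i by (rule completion_time_mono[OF X]) simp
    show "?S (i + 2) \<le> 4 * (?S (i + 1) - ?S i)" for i
      \<comment> \<open>The robustness bound is taken at \<open>i + 1\<close>, where
        \<open>X (i + 1)\<close> is an increment of the completion times.\<close>
      using robust_schedule_completion_time_le[OF assms, of "i + 1"]
        completion_time_step[OF X, of i] by (simp add: add.assoc)
  qed
  have X_S: "X (i + 1) = ?S i" for i
    using S2[of i] completion_time_step[OF X, of i] by simp
  have X2: "X (i + 1) = 2 * X i" for i
    using S2[of "i - 1"] X_S[of "i - 1"] X_S[of i] by simp
  \<comment> \<open>The offset may be any real; its integer part accounts for the index
    shift.\<close>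
  have "X i = doubling_schedule (log 2 (X 0)) i" for i
  proof (induction i rule: int_induct[where k = 0])
    case base
    show ?case using pos[of 0] by (simp add: doubling_schedule_def)
  next
    case (step1 i)
    then show ?case using X2[of i] by (simp add: doubling_schedule_def powr_add)
  next
    case (step2 i)
    then show ?case using X2[of "i - 1"] by (simp add: doubling_schedule_def powr_add powr_diff)
  qed
  then show ?thesis using that by blast
qed


section \<open>Doubling schedules\<close>

text \<open>Counting indices downwards from \<open>i\<close> gives a geometric series of ratio
  1/2.\<close>

lemma has_sum_doubling_schedule:
  "(doubling_schedule \<delta> has_sum 2 powr (of_int i + 1 + \<delta>)) {..i}"
proof -
  let ?h = "\<lambda>n. i - int n"
  have "(\<lambda>n. (1 / 2 :: real) ^ n) sums 2"
    using geometric_sums[of "1 / 2 :: real"] by simp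
  then have "(\<lambda>n. 2 powr (of_int i + \<delta>) * (1 / 2) ^ n) sums (2 powr (of_int i + \<delta>) * 2)"
    by (rule sums_mult)
  then have "((\<lambda>n. 2 powr (of_int i + \<delta>) * (1 / 2) ^ n) has_sum (2 powr (of_int i + \<delta>) * 2)) UNIV"
    by (intro sums_nonneg_imp_has_sum) auto
  also have "(\<lambda>n. 2 powr (of_int i + \<delta>) * (1 / 2) ^ n) = doubling_schedule \<delta> \<circ> ?h"
    by (auto simp: doubling_schedule_def powr_add powr_diff powr_realpow field_simps)
  also have "2 powr (of_int i + \<delta>) * 2 = 2 powr (of_int i + 1 + \<delta>)"
    by (simp add: powr_add)
  finally have "(doubling_schedule \<delta> has_sum 2 powr (of_int i + 1 + \<delta>)) (range ?h)"
    by (subst has_sum_reindex) (simp_all add: inj_on_def o_def)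
  also have "range ?h = {..i}"
  proof
    show "{..i} \<subseteq> range ?h"
    proof
      fix j assume "j \<in> {..i}"
      then have "j = ?h (nat (i - j))" by simp
      then show "j \<in> range ?h" by blast
    qed
  qed auto
  finally show ?thesis .
qed

lemma completion_time_doubling:
  "completion_time (doubling_schedule \<delta>) i = 2 powr (of_int i + 1 + \<delta>)"
  unfolding completion_time_def using has_sum_doubling_schedule by (rule infsumI)

lemma contract_schedule_doubling: "contract_schedule (doubling_schedule \<delta>)"
  unfolding contract_schedule_def
  using has_sum_doubling_schedule
  by (auto simp: summable_on_def strict_mono_def doubling_schedule_def)

lemma doubling_ratio:
  assumes "0 < T"
  shows "T / longest_completed (doubling_schedule \<delta>) T = 2 powr (1 + frac (log 2 T - \<delta>))"
proof -
  \<comment> \<open>The shift by 1 is due to contract \<open>i\<close> completing at twice its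
    length.\<close>
  define i where "i = \<lfloor>log 2 T - \<delta>\<rfloor> - 1"
  have i: "of_int i + 1 + \<delta> \<le> log 2 T" "log 2 T < of_int i + 2 + \<delta>"
    unfolding i_def by linarith+
  have T: "T = 2 powr log 2 T" using assms by simp
  have "longest_completed (doubling_schedule \<delta>) T = doubling_schedule \<delta> i"
  proof (rule longest_completed_eq[OF contract_schedule_doubling])
    show "completion_time (doubling_schedule \<delta>) i \<le> T"
      unfolding completion_time_doubling using i(1) by (subst T) simp
    show "T < completion_time (doubling_schedule \<delta>) (i + 1)"
      unfolding completion_time_doubling using i(2) by (subst T) (simp add: add_ac)
  qed
  then have "T / longest_completed (doubling_schedule \<delta>) T
      = 2 powr (log 2 T - (of_int i + \<delta>))"
    using assms by (simp add: doubling_schedule_def powr_diff)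
  also have "log 2 T - (of_int i + \<delta>) = 1 + frac (log 2 T - \<delta>)"
    by (simp add: i_def frac_def)
  finally show ?thesis .
qed

lemma robust_schedule_doubling: "robust_schedule 4 (doubling_schedule \<delta>)"
  unfolding robust_schedule_def robustness_def
proof (intro conjI SUP_least contract_schedule_doubling)
  fix T :: real assume "T \<in> {0<..}"
  then have "T / longest_completed (doubling_schedule \<delta>) T = 2 powr (1 + frac (log 2 T - \<delta>))"
    by (simp add: doubling_ratio)
  also have "\<dots> \<le> 2 powr 2"
    using frac_lt_1[of "log 2 T - \<delta>"] by (intro powr_mono) auto
  finally show "ereal (T / longest_completed (doubling_schedule \<delta>) T) \<le> ereal 4" by simp
qed

section \<open>Optimality of an offset taken from the inputs\<close>

text \<open>For nonempty \<open>P\<close> of positive reals and positive \<open>\<rho>\<close>, the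
  doubling schedule with a contract completing exactly at \<open>\<rho>\<close> has consistency
  \<open>2 powr (1 + spread P \<rho>)\<close>. The inserted 0 is the starting value of the running
  maximum.\<close>

definition spread :: "real set \<Rightarrow> real \<Rightarrow> real" where
  "spread P \<rho> = Max (insert 0 ((\<lambda>\<tau>. frac (log 2 (\<tau> / \<rho>))) ` P))"

lemma spread_empty [simp]: "spread {} \<rho> = 0"
  by (simp add: spread_def)

lemma spread_insert:
  "finite P \<Longrightarrow> spread (insert \<tau> P) \<rho> = max (spread P \<rho>) (frac (log 2 (\<tau> / \<rho>)))"
  by (simp add: spread_def insert_commute[of 0] max.commute)

lemma spread_less_1: "finite P \<Longrightarrow> spread P \<rho> < 1"
  by (auto simp: spread_def frac_lt_1)

text \<open>Increasing \<open>\<alpha>\<close> until a contract completes exactly at some \<open>\<rho> \<in> P\<close> lowers all exponents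
  \<open>frac (log 2 \<tau> - \<alpha>)\<close> by the same amount.\<close>

lemma consistency_doubling_le_if_minimal:
  fixes P :: "real set"
  assumes fin: "finite P" and pos: "\<And>\<tau>. \<tau> \<in> P \<Longrightarrow> 0 < \<tau>" and \<sigma>: "\<sigma> \<in> P"
    and min: "\<And>\<rho>. \<rho> \<in> P \<Longrightarrow> spread P \<sigma> \<le> spread P \<rho>"
    and Y: "robust_schedule 4 Y"
  shows "consistency (doubling_schedule (frac (log 2 \<sigma>))) P \<le> consistency Y P"
proof -
  obtain \<alpha> where \<alpha>: "Y = doubling_schedule \<alpha>"
    using Y by (rule robust_schedule_4_imp_doubling)
  define e where "e \<tau> = frac (log 2 \<tau> - \<alpha>)" for \<tau>
  have ne: "P \<noteq> {}" using \<sigma> by auto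
  have "Min (e ` P) \<in> e ` P" "Max (e ` P) \<in> e ` P"
    using fin ne by (auto intro: Min_in Max_in)
  \<comment> \<open>\<open>\<rho>\<close> is the first input met when the offset increases from
    \<open>\<alpha>\<close>; \<open>\<mu>\<close> is the worst interruption for
    \<open>Y\<close>.\<close>
  then obtain \<rho> \<mu> where \<rho>: "\<rho> \<in> P" "e \<rho> = Min (e ` P)" and \<mu>: "\<mu> \<in> P" "e \<mu> = Max (e ` P)"
    by (metis imageE)
  have "frac (log 2 (\<tau> / \<rho>)) \<le> e \<mu>" if "\<tau> \<in> P" for \<tau>
  proof -
    \<comment> \<open>Minimality of \<open>e \<rho>\<close> excludes a wrap-around of the fractional
      part.\<close>
    have "e \<rho> \<le> e \<tau>" using \<rho> that fin by simp
    then have "frac (log 2 \<tau> - \<alpha> - (log 2 \<rho> - \<alpha>)) = e \<tau> - e \<rho>"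
      unfolding e_def by (rule frac_diff_pos)
    then have "frac (log 2 (\<tau> / \<rho>)) = e \<tau> - e \<rho>"
      using pos[OF that] pos[OF \<rho>(1)] by (simp add: log_divide)
    also have "\<dots> \<le> e \<tau>" by (simp add: e_def)
    also have "\<dots> \<le> e \<mu>" using \<mu> that fin by simp
    finally show ?thesis .
  qed
  then have "spread P \<rho> \<le> e \<mu>" using fin by (simp add: spread_def e_def)
  then have spread_le: "spread P \<sigma> \<le> e \<mu>" using min[OF \<rho>(1)] by simp
  show ?thesis
    unfolding consistency_def
  proof (rule SUP_least)
    fix \<tau> assume \<tau>: "\<tau> \<in> P"
    have "frac (log 2 \<tau> - frac (log 2 \<sigma>)) = frac (log 2 (\<tau> / \<sigma>))"
      using pos[OF \<tau>] pos[OF \<sigma>] by (simp add: frac_diff_simp log_divide)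
    also have "\<dots> \<le> spread P \<sigma>" using \<tau> fin by (simp add: spread_def)
    also note spread_le
    finally have "ereal (\<tau> / longest_completed (doubling_schedule (frac (log 2 \<sigma>))) \<tau>)
        \<le> ereal (\<mu> / longest_completed Y \<mu>)"
      using pos[OF \<tau>] pos[OF \<mu>(1)] by (simp add: \<alpha> doubling_ratio e_def)
    also have "\<dots> \<le> (SUP \<tau>\<in>P. ereal (\<tau> / longest_completed Y \<tau>))"
      using \<mu>(1) by (rule SUP_upper)
    finally show "ereal (\<tau> / longest_completed (doubling_schedule (frac (log 2 \<sigma>))) \<tau>)
        \<le> (SUP \<tau>\<in>P. ereal (\<tau> / longest_completed Y \<tau>))" .
  qed
qed


section \<open>Total correctness with time bounds\<close>

text \<open>An upper bound instead of an exact step count lets branches of different cost share one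
  bound.\<close>

definition halts_within :: "com \<Rightarrow> state \<Rightarrow> nat \<Rightarrow> (state \<Rightarrow> bool) \<Rightarrow> bool" where
  "halts_within c s t Q \<longleftrightarrow> (\<exists>n s'. exec c s n s' \<and> n \<le> t \<and> Q s')"

lemma halts_within_mono:
  "halts_within c s t Q \<Longrightarrow> t \<le> t' \<Longrightarrow> (\<And>s. Q s \<Longrightarrow> Q' s) \<Longrightarrow> halts_within c s t' Q'"
  unfolding halts_within_def by (meson le_trans)

text \<open>\<open>Skip\<close> gets a free bound because it serves as an empty branch and must
  match the cost of the other branch.\<close>

lemma halts_within_atomic:
  "1 \<le> t \<Longrightarrow> Q s \<Longrightarrow> halts_within Skip s t Q"
  "Q (R(a := m), M) \<Longrightarrow> halts_within (Index_Const a m) (R, M) 1 Q"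
  "Q (R(a := R b + R c), M) \<Longrightarrow> halts_within (Index_Add a b c) (R, M) 1 Q"
  "Q (R, M(R a := of_int z)) \<Longrightarrow> halts_within (Real_Const a z) (R, M) 1 Q"
  "unop_defined f (M (R b)) \<Longrightarrow> Q (R, M(R a := unop_val f (M (R b)))) \<Longrightarrow>
    halts_within (Real_Un f a b) (R, M) 1 Q"
  "binop_defined g (M (R b)) (M (R c)) \<Longrightarrow> Q (R, M(R a := binop_val g (M (R b)) (M (R c)))) \<Longrightarrow>
    halts_within (Real_Bin g a b c) (R, M) 1 Q"
  unfolding halts_within_def by (blast intro: exec.intros order.refl)+

text \<open>Nesting the claim on \<open>c2\<close> in the postcondition of \<open>c1\<close> makes
  repeated introduction act as symbolic execution.\<close>

lemma halts_within_Seq: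
  assumes "halts_within c1 s t1 (\<lambda>s'. halts_within c2 s' t2 Q)"
  shows "halts_within (Seq c1 c2) s (t1 + t2) Q"
proof -
  obtain n1 s' n2 s'' where "exec c1 s n1 s'" "n1 \<le> t1" "exec c2 s' n2 s''" "n2 \<le> t2" "Q s''"
    using assms unfolding halts_within_def by blast
  then show ?thesis unfolding halts_within_def by (blast intro: exec.Seq add_mono)
qed

lemma halts_within_If:
  assumes "test_val b s \<Longrightarrow> halts_within c1 s t Q" "\<not> test_val b s \<Longrightarrow> halts_within c2 s t Q"
  shows "halts_within (If_Then_Else b c1 c2) s (Suc t) Q"
proof (cases "test_val b s")
  case True
  then obtain n s' where "exec c1 s n s'" "n \<le> t" "Q s'"
    using assms(1) unfolding halts_within_def by blast
  with True show ?thesis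
    unfolding halts_within_def by (blast intro: exec.If_True Suc_le_mono[THEN iffD2])
next
  case False
  then obtain n s' where "exec c2 s n s'" "n \<le> t" "Q s'"
    using assms(2) unfolding halts_within_def by blast
  with False show ?thesis
    unfolding halts_within_def by (blast intro: exec.If_False Suc_le_mono[THEN iffD2])
qed

text \<open>The invariant is indexed by the iteration number; each of the \<open>N\<close> rounds
  pays for its test and body, and the final 1 is the failing test.\<close>

lemma halts_within_While:
  assumes step: "\<And>i s. i < N \<Longrightarrow> I i s \<Longrightarrow> test_val b s \<and> halts_within c s t (I (Suc i))"
    and stop: "\<And>s. I N s \<Longrightarrow> \<not> test_val b s"
    and init: "I 0 s"
  shows "halts_within (While b c) s (N * Suc t + 1) (I N)"
proof -
  have "halts_within (While b c) s ((N - i) * Suc t + 1) (I N)" if "i \<le> N" "I i s" for i s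
    using that
  proof (induction "N - i" arbitrary: i s)
    case 0
    then show ?case
      unfolding halts_within_def using stop[of s] exec.While_False[of b s c]
      by (intro exI[of _ 1] exI[of _ s]) auto
  next
    case (Suc m)
    then have "i < N" by simp
    with step Suc.prems obtain n s' where 1: "test_val b s" "exec c s n s'" "n \<le> t" "I (Suc i) s'"
      unfolding halts_within_def by blast
    have "halts_within (While b c) s' ((N - Suc i) * Suc t + 1) (I N)"
      using Suc \<open>i < N\<close> 1 by (intro Suc.hyps(1)) auto
    then obtain n' s'' where 2: "exec (While b c) s' n' s''" "n' \<le> (N - Suc i) * Suc t + 1" "I N s''"
      unfolding halts_within_def by blast
    have "N - i = Suc (N - Suc i)" using \<open>i < N\<close> by simp
    then have "Suc (n + n') \<le> (N - i) * Suc t + 1" using 1(3) 2(2) by simp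
    then show ?case
      unfolding halts_within_def using exec.While_True[OF 1(1,2) 2(1)] 2(3) by blast
  qed
  from this[of 0 s] init show ?thesis by simp
qed


section \<open>The program\<close>

text \<open>Register 0 holds the number \<open>k\<close> of inputs, registers 2 and 3 are the loop counters, and
  registers 5 to 8 address the cells after \<open>k\<close>. Cell \<open>k\<close> accumulates the spread of the current
  candidate, cells \<open>k + 2\<close> and \<open>k + 3\<close> hold the smallest spread so far and a candidate attaining it.
  Registers that are never assigned hold 0, so register 9 addresses the output.\<close>

definition spread_body :: com where
  "spread_body =
     Seq (Real_Bin Div 5 3 2)
    (Seq (Real_Un Log2 5 5)
    (Seq (Real_Un Floor 8 5)
    (Seq (Real_Bin Sub 5 5 8)
    (Seq (If_Then_Else (Real_Less 0 5) (Real_Un Copy 0 5) Skip)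
         (Index_Add 3 3 1)))))"

text \<open>Register 0 is both the loop bound \<open>k\<close> and the address of the accumulator,
  so \<open>Real_Const 0 0\<close> clears cell \<open>k\<close> and leaves the inputs
  intact.\<close>

definition candidate_body :: com where
  "candidate_body =
     Seq (Real_Const 0 0)
    (Seq (Index_Const 3 0)
    (Seq (While (Index_Less 3 0) spread_body)
    (Seq (If_Then_Else (Real_Less 0 6) (Seq (Real_Un Copy 6 0) (Real_Un Copy 7 2)) Skip)
         (Index_Add 2 2 1))))"

definition schedule_program :: com where
  "schedule_program =
     Seq (Index_Const 1 1)
    (Seq (Index_Add 5 0 1)
    (Seq (Index_Add 6 5 1)
    (Seq (Index_Add 7 6 1)
    (Seq (Index_Add 8 7 1)
    (Seq (Real_Const 6 1)
    (Seq (Real_Const 7 1)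
    (Seq (While (Index_Less 2 0) candidate_body)
    (Seq (Real_Un Log2 7 7)
    (Seq (Real_Un Floor 8 7)
         (Real_Bin Sub 9 7 8))))))))))"

section \<open>Loop invariants and verification\<close>

definition layout :: "real list \<Rightarrow> (nat \<Rightarrow> nat) \<Rightarrow> (nat \<Rightarrow> real) \<Rightarrow> bool" where
  "layout xs R M \<longleftrightarrow> (let k = length xs in
     R 0 = k \<and> R 1 = 1 \<and> R 5 = k + 1 \<and> R 6 = k + 2 \<and> R 7 = k + 3 \<and> R 8 = k + 4 \<and> R 9 = 0 \<and>
     (\<forall>l<k. M l = xs ! l))"

text \<open>The parameters \<open>v\<close> and \<open>b\<close> record that the inner loop
  preserves the best pair found so far.\<close>

definition spread_inv :: "real list \<Rightarrow> nat \<Rightarrow> real \<Rightarrow> real \<Rightarrow> nat \<Rightarrow> state \<Rightarrow> bool" where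
  "spread_inv xs i v b j = (\<lambda>(R, M). let k = length xs in
     layout xs R M \<and> R 2 = i \<and> R 3 = j \<and>
     M k = spread (set (take j xs)) (xs ! i) \<and> M (k + 2) = v \<and> M (k + 3) = b)"

text \<open>The initial pair is a sentinel: the value 1 exceeds every spread, and the candidate 1
  keeps the final logarithm defined on empty input.\<close>

definition best_candidate :: "real list \<Rightarrow> nat \<Rightarrow> real \<Rightarrow> real \<Rightarrow> bool" where
  "best_candidate xs i v b \<longleftrightarrow>
     (if i = 0 then v = 1 \<and> b = 1
      else b \<in> set (take i xs) \<and> v = spread (set xs) b \<and>
        (\<forall>\<rho>\<in>set (take i xs). v \<le> spread (set xs) \<rho>))"

definition candidate_inv :: "real list \<Rightarrow> nat \<Rightarrow> state \<Rightarrow> bool" where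
  "candidate_inv xs i = (\<lambda>(R, M). let k = length xs in
     layout xs R M \<and> R 2 = i \<and> best_candidate xs i (M (k + 2)) (M (k + 3)))"

lemma set_take_Suc: "j < length xs \<Longrightarrow> set (take (Suc j) xs) = insert (xs ! j) (set (take j xs))"
  by (simp add: take_Suc_conv_app_nth)

text \<open>At \<open>i = 0\<close> the spread is below the sentinel 1, so the second claim is
  vacuous there.\<close>

lemma best_candidate_step:
  assumes "i < length xs" "best_candidate xs i v b"
  shows "spread (set xs) (xs ! i) < v \<Longrightarrow>
      best_candidate xs (Suc i) (spread (set xs) (xs ! i)) (xs ! i)"
    and "\<not> spread (set xs) (xs ! i) < v \<Longrightarrow> best_candidate xs (Suc i) v b"
  using assms spread_less_1[of "set xs" "xs ! i"]
  by (auto simp: best_candidate_def set_take_Suc split: if_splits)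

lemma halts_within_spread_body:
  assumes pos: "\<forall>x\<in>set xs. 0 < x" and i: "i < length xs" and j: "j < length xs"
    and inv: "spread_inv xs i v b j s"
  shows "halts_within spread_body s 7 (spread_inv xs i v b (Suc j))"
proof -
  obtain R M where s: "s = (R, M)" by (cases s)
  let ?k = "length xs"
  have R: "R 0 = ?k" "R (Suc 0) = 1" "R 2 = i" "R 3 = j" "R 5 = ?k + 1" "R 6 = ?k + 2"
      "R 7 = ?k + 3" "R 8 = ?k + 4" "R 9 = 0"
    and M: "\<And>l. l < ?k \<Longrightarrow> M l = xs ! l" "M ?k = spread (set (take j xs)) (xs ! i)"
      "M (Suc (Suc ?k)) = v" "M (?k + 3) = b"
    using inv by (auto simp: s spread_inv_def layout_def Let_def)
  \<comment> \<open>Positivity makes the division and the logarithm defined.\<close>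
  have "0 < xs ! i" "0 < xs ! j" using pos i j by auto
  \<comment> \<open>The bound mirrors the syntax tree of the program so that the introduction rules
    unify.\<close>
  then have "halts_within spread_body s (1 + (1 + (1 + (1 + (Suc 1 + 1)))))
      (spread_inv xs i v b (Suc j))"
    unfolding spread_body_def s using i j
    by (intro halts_within_Seq halts_within_atomic halts_within_If)
      (auto simp: R M spread_inv_def layout_def set_take_Suc spread_insert frac_def Let_def)
  then show ?thesis by (rule halts_within_mono) auto
qed

text \<open>The inner loop costs \<open>8 * k + 1\<close>, the two resets 2, and the update with the
  increment at most 4.\<close>

lemma halts_within_candidate_body:
  assumes pos: "\<forall>x\<in>set xs. 0 < x" and i: "i < length xs" and inv: "candidate_inv xs i s"
  shows "halts_within candidate_body s (8 * length xs + 7) (candidate_inv xs (Suc i))"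
proof -
  obtain R M where s: "s = (R, M)" by (cases s)
  let ?k = "length xs"
  define v b where "v = M (?k + 2)" and "b = M (?k + 3)"
  have lay: "layout xs R M" and best: "best_candidate xs i v b" and R2: "R 2 = i"
    using inv by (auto simp: s candidate_inv_def Let_def v_def b_def)
  let ?s = "(R(3 := 0), M(R 0 := of_int 0))"
  have init: "spread_inv xs i v b 0 ?s"
    using lay R2 by (auto simp: spread_inv_def layout_def Let_def v_def b_def)
  have loop: "halts_within (While (Index_Less 3 0) spread_body) ?s (?k * Suc 7 + 1)
      (spread_inv xs i v b ?k)"
  proof (rule halts_within_While[where I = "spread_inv xs i v b", OF _ _ init])
    fix j s assume "j < ?k" "spread_inv xs i v b j s"
    then show "test_val (Index_Less 3 0) s \<and> halts_within spread_body s 7 (spread_inv xs i v b (Suc j))"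
      using halts_within_spread_body[OF pos i, of j v b s]
      by (auto simp: spread_inv_def layout_def Let_def)
  next
    fix s assume "spread_inv xs i v b ?k s"
    then show "\<not> test_val (Index_Less 3 0) s"
      by (auto simp: spread_inv_def layout_def Let_def)
  qed
  let ?upd = "Seq (If_Then_Else (Real_Less 0 6) (Seq (Real_Un Copy 6 0) (Real_Un Copy 7 2)) Skip)
         (Index_Add 2 2 1)"
  have upd: "halts_within ?upd s' 4 (candidate_inv xs (Suc i))" if "spread_inv xs i v b ?k s'" for s'
  proof -
    obtain R' M' where s': "s' = (R', M')" by (cases s')
    have R: "R' 0 = ?k" "R' (Suc 0) = 1" "R' 2 = i" "R' 5 = ?k + 1" "R' 6 = ?k + 2"
        "R' 7 = ?k + 3" "R' 8 = ?k + 4" "R' 9 = 0"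
      and M: "\<And>l. l < ?k \<Longrightarrow> M' l = xs ! l" "M' ?k = spread (set xs) (xs ! i)"
        "M' (Suc (Suc ?k)) = v" "M' (?k + 3) = b"
      using that by (auto simp: s' spread_inv_def layout_def Let_def)
    have "halts_within ?upd s' (Suc (1 + 1) + 1) (candidate_inv xs (Suc i))"
      unfolding s' using i best_candidate_step[OF i best]
      by (intro halts_within_Seq halts_within_If halts_within_atomic)
        (auto simp: R M candidate_inv_def layout_def Let_def)
    then show ?thesis by (rule halts_within_mono) auto
  qed
  have "halts_within candidate_body s (1 + (1 + ((?k * Suc 7 + 1) + 4))) (candidate_inv xs (Suc i))"
    unfolding candidate_body_def s
    by (intro halts_within_Seq halts_within_atomic halts_within_mono[OF loop order.refl upd])
  then show ?thesis by (rule halts_within_mono) auto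
qed

text \<open>The outer loop costs at most \<open>k * (8 * k + 8) + 1\<close>; setup adds 7 and the
  final fractional part 3.\<close>

lemma halts_within_schedule_program:
  assumes pos: "\<forall>x\<in>set xs. 0 < x"
  shows "halts_within schedule_program (input_state xs) (8 * length xs ^ 2 + 8 * length xs + 11)
    (\<lambda>s. \<exists>v b. best_candidate xs (length xs) v b \<and> result s = frac (log 2 b))"
proof -
  let ?k = "length xs"
  let ?Q = "\<lambda>s. \<exists>v b. best_candidate xs ?k v b \<and> result s = frac (log 2 b)"
  let ?fin = "Seq (Real_Un Log2 7 7) (Seq (Real_Un Floor 8 7) (Real_Bin Sub 9 7 8))"
  have loop: "halts_within (While (Index_Less 2 0) candidate_body) s (?k * Suc (8 * ?k + 7) + 1)
      (candidate_inv xs ?k)" if "candidate_inv xs 0 s" for s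
  proof (rule halts_within_While[where I = "candidate_inv xs", OF _ _ that])
    fix i s assume "i < ?k" "candidate_inv xs i s"
    then show "test_val (Index_Less 2 0) s \<and>
        halts_within candidate_body s (8 * ?k + 7) (candidate_inv xs (Suc i))"
      using halts_within_candidate_body[OF pos, of i s]
      by (auto simp: candidate_inv_def layout_def Let_def)
  next
    fix s assume "candidate_inv xs ?k s"
    then show "\<not> test_val (Index_Less 2 0) s"
      by (auto simp: candidate_inv_def layout_def Let_def)
  qed
  have fin: "halts_within ?fin s 3 ?Q" if "candidate_inv xs ?k s" for s
  proof -
    obtain R M where s: "s = (R, M)" by (cases s)
    have best: "best_candidate xs ?k (M (?k + 2)) (M (?k + 3))"
      and R: "R 7 = ?k + 3" "R 8 = ?k + 4" "R 9 = 0"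
      using that by (auto simp: s candidate_inv_def layout_def Let_def)
    have "0 < M (?k + 3)" using best pos by (auto simp: best_candidate_def split: if_splits)
    then have "halts_within ?fin s (1 + (1 + 1)) ?Q"
      unfolding s
      using best by (intro halts_within_Seq halts_within_atomic) (auto simp: R result_def frac_def)
    then show ?thesis by (rule halts_within_mono) auto
  qed
  have "halts_within schedule_program (input_state xs)
      (1 + (1 + (1 + (1 + (1 + (1 + (1 + ((?k * Suc (8 * ?k + 7) + 1) + 3)))))))) ?Q"
    unfolding schedule_program_def input_state_def
    by (intro halts_within_Seq halts_within_atomic halts_within_mono[OF loop order.refl fin])
      (auto simp: candidate_inv_def layout_def best_candidate_def Let_def)
  then show ?thesis
    by (rule halts_within_mono) (auto simp: power2_eq_square algebra_simps)
qed

theorem theorem5: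
  "\<exists>(prog :: com) (time :: nat \<Rightarrow> nat).
     (\<lambda>k. real (time k)) \<in> O(\<lambda>k. real k ^ 2) \<and>
     (\<forall>\<tau>s :: real list. distinct \<tau>s \<and> (\<forall>\<tau>\<in>set \<tau>s. 0 < \<tau>) \<longrightarrow>
       (\<exists>n s. exec prog (input_state \<tau>s) n s \<and> n \<le> time (length \<tau>s) \<and>
          0 \<le> result s \<and> result s < 1 \<and>
          robust_schedule 4 (doubling_schedule (result s)) \<and>
          (\<forall>Y. robust_schedule 4 Y \<longrightarrow>
             consistency (doubling_schedule (result s)) (set \<tau>s) \<le> consistency Y (set \<tau>s))))"
proof (rule exI[of _ schedule_program], rule exI[of _ "\<lambda>k. 8 * k ^ 2 + 8 * k + 11"],
    intro conjI allI impI)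
  let ?time = "\<lambda>k :: nat. 8 * k ^ 2 + 8 * k + 11"
  \<comment> \<open>27 is the sum of the coefficients 8, 8 and 11.\<close>
  have bound: "?time k \<le> 27 * k ^ 2" if "1 \<le> k" for k
    using that power_increasing[of 1 2 k] by (simp add: Suc_le_eq)
  have "real (?time k) \<le> 27 * real k ^ 2" if "1 \<le> k" for k
    using of_nat_mono[OF bound[OF that], where 'a = real] by simp
  then show "(\<lambda>k. real (?time k)) \<in> O(\<lambda>k. real k ^ 2)"
    by (intro bigoI[where c = 27] eventually_at_top_linorderI[of 1]) simp
next
  fix \<tau>s :: "real list"
  assume "distinct \<tau>s \<and> (\<forall>\<tau>\<in>set \<tau>s. 0 < \<tau>)"
  then have pos: "\<forall>\<tau>\<in>set \<tau>s. 0 < \<tau>" by blast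
  obtain n s v b where exec: "exec schedule_program (input_state \<tau>s) n s"
      "n \<le> 8 * length \<tau>s ^ 2 + 8 * length \<tau>s + 11"
    and best: "best_candidate \<tau>s (length \<tau>s) v b" and res: "result s = frac (log 2 b)"
    using halts_within_schedule_program[OF pos] unfolding halts_within_def by blast
  have "consistency (doubling_schedule (result s)) (set \<tau>s) \<le> consistency Y (set \<tau>s)"
    if "robust_schedule 4 Y" for Y
  proof (cases "\<tau>s = []")
    \<comment> \<open>Both consistencies are suprema over the empty set and hence equal.\<close>
    case True
    then show ?thesis by (simp add: consistency_def)
  next
    case False
    then show ?thesis
      unfolding res using best pos that
      by (intro consistency_doubling_le_if_minimal) (auto simp: best_candidate_def)
  qed
  then show "\<exists>n s. exec schedule_program (input_state \<tau>s) n s \<and>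
      n \<le> 8 * length \<tau>s ^ 2 + 8 * length \<tau>s + 11 \<and> 0 \<le> result s \<and> result s < 1 \<and>
      robust_schedule 4 (doubling_schedule (result s)) \<and>
      (\<forall>Y. robust_schedule 4 Y \<longrightarrow>
         consistency (doubling_schedule (result s)) (set \<tau>s) \<le> consistency Y (set \<tau>s))"
    using exec res frac_lt_1 robust_schedule_doubling by (metis frac_ge_0)
qed

end
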